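(* Let $m,G\ge 1$ and let the coordinates of $\mathbb{R}^m$ be partitioned into $G$ consecutive groups. Let $\lambda>0$, let $\Sigma_t\in\mathbb{R}^{m\times m}$ be symmetric positive semidefinite, and let $H_{t-1}:=\operatorname{blkdiag}\big(H^{(1)}_{t-1},\dots,H^{(G)}_{t-1}\big)\in\mathbb{R}^{m\times m}$, where for each group $g$ the block $H^{(g)}_{t-1}$ (acting on the coordinates of group $g$) is a fixed symmetric positive semidefinite matrix. Assume $\ker(\Sigma_t)\cap\ker(H_{t-1})=\{0\}$. Let $v_t^*,v_{t-1}\in\mathbb{R}^m$ and define, for $v\in\mathbb{R}^m$, $$L_t(v)=\frac12\,(v-v_t^* )^\top \Sigma_t (v-v_t^* )+\frac{\lambda}{2}\,(v-v_{t-1})^\top H_{t-1} (v-v_{t-1}).$$ Let $\hat v_t:=\arg\min_{v\in\mathbb{R}^m} L_t(v)$. Let $r=\operatorname{rank}(H_{t-1})$ and let $\{(q_k,\rho_k)\}_{k=1}^{r}$ be generalized eigenpairs of $(\Sigma_t,H_{t-1})$ on $\mathrm{range}(H_{t-1})$, i.e. $q_k\in\mathrm{range}(H_{t-1})$, $\rho_k\in\mathbb{R}$ and $\Sigma_t q_k=\rho_k H_{t-1} q_k$, normalized by $q_i^\top H_{t-1} q_j=\delta_{ij}$. Then, with $\langle u,w\rangle_{H_{t-1}}:=u^\top H_{t-1} w$, $$\langle \hat v_t ,q_k\rangle_{H_{t-1}}=\frac{\rho_k}{\rho_k+\lambda}\,\langle v_t^*,q_k\rangle_{H_{t-1}}+\frac{\lambda}{\rho_k+\lambda}\,\langle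 v_{t-1},q_k\rangle_{H_{t-1}},\qquad k=1,\dots,r.$$
   Context: $\operatorname{blkdiag}$ denotes the block-diagonal matrix with the given diagonal blocks. $\delta_{ij}$ is the Kronecker delta. The subscript $t$ is a fixed stage index and plays no role beyond labelling; all matrices and the vectors $v_t^*$, $v_{t-1}$ are constants not depending on $v$. *)

theory Defs
  imports "Jordan_Normal_Form.Matrix_Kernel" "Jordan_Normal_Form.DL_Rank"
begin

definition sym_psd :: "nat \<Rightarrow> real mat \<Rightarrow> bool" where
  "sym_psd n A \<longleftrightarrow> A \<in> carrier_mat n n \<and> transpose_mat A = A
     \<and> (\<forall>x\<in>carrier_vec n. 0 \<le> x \<bullet> (A *\<^sub>v x))"

definition mat_range :: "real mat \<Rightarrow> real vec set" where
  "mat_range A = (\<lambda>x. A *\<^sub>v x) ` carrier_vec (dim_col A)"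

definition mat_inner :: "real mat \<Rightarrow> real vec \<Rightarrow> real vec \<Rightarrow> real" where
  "mat_inner H u w = u \<bullet> (H *\<^sub>v w)"

definition stage_loss ::
  "real \<Rightarrow> real mat \<Rightarrow> real mat \<Rightarrow> real vec \<Rightarrow> real vec \<Rightarrow> real vec \<Rightarrow> real" where
  "stage_loss lam S H vstar vprev v =
     1 / 2 * ((v - vstar) \<bullet> (S *\<^sub>v (v - vstar)))
     + lam / 2 * ((v - vprev) \<bullet> (H *\<^sub>v (v - vprev)))"

(* q \<noteq> 0 is not required here; it follows wherever the pair is H-normalised. *)
definition gen_eigenpair_on_range ::
  "real mat \<Rightarrow> real mat \<Rightarrow> real vec \<Rightarrow> real \<Rightarrow> bool" where
  "gen_eigenpair_on_range S H q \<rho> \<longleftrightarrow>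
     q \<in> mat_range H \<and> S *\<^sub>v q = \<rho> \<cdot>\<^sub>v (H *\<^sub>v q)"

end

theory Submission
  imports Defs "Jordan_Normal_Form.Determinant"
begin

text \<open>
  The Hessian \<open>S + lam H\<close> is positive semidefinite and its kernel is the intersection of
  the two kernels, so it is positive definite and the unique minimiser is the solution of the
  normal equation \<open>S v + lam H v = S vstar + lam H vprev\<close>. Pairing this equation with an
  eigenvector \<open>q\<close> and moving \<open>S\<close> and \<open>H\<close> onto \<open>q\<close> by symmetry gives
  \<open>(\<rho> + lam) \<langle>v, q\<rangle> = \<rho> \<langle>vstar, q\<rangle> + lam \<langle>vprev, q\<rangle>\<close>.
\<close>

text \<open>Splitting a vector as \<open>u @\<^sub>v w\<close> along the blocks turns the form into
  the sum of the two block forms, with no cross terms.\<close>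

lemma sym_psd_four_block_diag:
  assumes A: "sym_psd a A" and B: "sym_psd b B"
  shows "sym_psd (a + b) (four_block_mat A (0\<^sub>m a b) (0\<^sub>m b a) B)"
proof -
  let ?M = "four_block_mat A (0\<^sub>m a b) (0\<^sub>m b a) B"
  have cA: "A \<in> carrier_mat a a" and tA: "transpose_mat A = A"
    and cB: "B \<in> carrier_mat b b" and tB: "transpose_mat B = B"
    using A B by (auto simp: sym_psd_def)
  have "0 \<le> x \<bullet> (?M *\<^sub>v x)" if "x \<in> carrier_vec (a + b)" for x
  proof -
    define u w where "u = vec_first x a" and "w = vec_last x b"
    have u: "u \<in> carrier_vec a" and w: "w \<in> carrier_vec b" and x: "x = u @\<^sub>v w"
      using that by (auto simp: u_def w_def)
    have "?M *\<^sub>v x = (A *\<^sub>v u) @\<^sub>v (B *\<^sub>v w)"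
      unfolding x using cA cB u w by (simp add: mult_mat_vec_split)
    then have "x \<bullet> (?M *\<^sub>v x) = u \<bullet> (A *\<^sub>v u) + w \<bullet> (B *\<^sub>v w)"
      using u w cA cB by (simp add: x scalar_prod_append[of _ a _ b])
    with A B u w show ?thesis by (simp add: sym_psd_def)
  qed
  moreover have "transpose_mat ?M = ?M"
    using cA cB tA tB by (subst transpose_four_block_mat[of _ a a _ b _ b]) auto
  ultimately show ?thesis using cA cB by (auto simp: sym_psd_def)
qed

text \<open>Peels off one block at a time. It carries the groupwise assumptions over to the whole
  matrix \<open>H\<close>; reading each size off as \<open>dim_row\<close> lets blocks of different
  sizes share one list.\<close>

lemma sym_psd_diag_block_mat:
  assumes "\<And>A. A \<in> set As \<Longrightarrow> sym_psd (dim_row A) A"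
  shows "sym_psd (sum_list (map dim_row As)) (diag_block_mat As)"
  using assms
proof (induction As)
  case Nil
  then show ?case by (auto simp: sym_psd_def scalar_prod_def)
next
  case (Cons A As)
  then have A: "sym_psd (dim_row A) A"
    and B: "sym_psd (sum_list (map dim_row As)) (diag_block_mat As)" by auto
  then have "dim_col A = dim_row A"
    and "dim_row (diag_block_mat As) = sum_list (map dim_row As)"
    and "dim_col (diag_block_mat As) = sum_list (map dim_row As)"
    by (auto simp: sym_psd_def)
  with sym_psd_four_block_diag[OF A B] show ?case by (simp add: Let_def)
qed

lemma symmetric_scalar_prod:
  fixes A :: "'a :: comm_semiring_0 mat"
  assumes "A \<in> carrier_mat n n" "transpose_mat A = A" "x \<in> carrier_vec n" "y \<in> carrier_vec n"
  shows "y \<bullet> (A *\<^sub>v x) = x \<bullet> (A *\<^sub>v y)"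
  using assms transpose_vec_mult_scalar[of A n n x y]
  by (metis comm_scalar_prod mult_mat_vec_carrier)

lemma quadratic_form_add:
  fixes A :: "'a :: comm_ring_1 mat"
  assumes "A \<in> carrier_mat n n" "transpose_mat A = A" "x \<in> carrier_vec n" "y \<in> carrier_vec n"
  shows "(x + y) \<bullet> (A *\<^sub>v (x + y)) = x \<bullet> (A *\<^sub>v x) + 2 * (y \<bullet> (A *\<^sub>v x)) + y \<bullet> (A *\<^sub>v y)"
  using assms symmetric_scalar_prod[OF assms]
  by (simp add: mult_add_distrib_mat_vec add_scalar_prod_distrib[of _ n]
      scalar_prod_add_distrib[of _ n])

text \<open>Along the line \<open>x + t y\<close> with \<open>y = A x\<close>, the form is a
  quadratic in \<open>t\<close> without constant term. Being nonnegative for every \<open>t\<close>,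
  it has zero linear coefficient, and that coefficient is twice the squared norm of
  \<open>y\<close>.\<close>

lemma sym_psd_quadratic_form_eq_0:
  assumes A: "sym_psd n A" and x: "x \<in> carrier_vec n" and 0: "x \<bullet> (A *\<^sub>v x) = 0"
  shows "A *\<^sub>v x = 0\<^sub>v n"
proof -
  have cA: "A \<in> carrier_mat n n" and tA: "transpose_mat A = A"
    using A by (auto simp: sym_psd_def)
  define y c s where "y = A *\<^sub>v x" and "c = y \<bullet> (A *\<^sub>v y)" and "s = y \<bullet> y"
  have y: "y \<in> carrier_vec n" using cA x by (simp add: y_def)
  have c: "c \<ge> 0" using A y by (simp add: c_def sym_psd_def)
  have ge: "0 \<le> 2 * t * s + t\<^sup>2 * c" for t
  proof -
    have "0 \<le> (x + t \<cdot>\<^sub>v y) \<bullet> (A *\<^sub>v (x + t \<cdot>\<^sub>v y))"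
      using A x y by (simp add: sym_psd_def)
    also have "\<dots> = 2 * t * s + t\<^sup>2 * c"
      using x y cA 0 by (subst quadratic_form_add[OF cA tA])
        (auto simp: y_def[symmetric] c_def s_def mult_mat_vec power2_eq_square)
    finally show ?thesis .
  qed
  have "s = 0"
  proof -
    \<comment> \<open>The quadratic would be minimal at \<open>t = - s / c\<close>, but
      \<open>c\<close> may vanish; dividing by \<open>c + 1\<close> is always legal and still makes
      the value at \<open>t = - u\<close> equal to \<open>- u\<^sup>2 * (c + 2)\<close>.\<close>
    define u where "u = s / (c + 1)"
    have su: "s = u * (c + 1)" using c by (simp add: u_def)
    have "0 \<le> 2 * (- u) * s + (- u)\<^sup>2 * c" by (rule ge)
    then have "u\<^sup>2 * (c + 2) \<le> 0" by (simp add: su power2_eq_square algebra_simps)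
    with c have "u = 0" by (simp add: mult_le_0_iff)
    then show ?thesis by (simp add: su)
  qed
  then show ?thesis
    using y by (auto simp: s_def y_def[symmetric] scalar_prod_def sum_nonneg_eq_0_iff)
qed

text \<open>A trivial kernel makes the determinant nonzero, hence the matrix invertible. This yields
  a solution of the normal equation, so existence of the minimiser needs no compactness
  argument.\<close>

lemma injective_mat_imp_surj:
  fixes A :: "'a :: field mat"
  assumes A: "A \<in> carrier_mat n n"
    and inj: "\<And>x. x \<in> carrier_vec n \<Longrightarrow> A *\<^sub>v x = 0\<^sub>v n \<Longrightarrow> x = 0\<^sub>v n"
    and b: "b \<in> carrier_vec n"
  obtains x where "x \<in> carrier_vec n" "A *\<^sub>v x = b"
proof -
  have "det A \<noteq> 0" using det_0_iff_vec_prod_zero[OF A] inj by auto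
  then obtain B where B: "B \<in> carrier_mat n n" "A * B = 1\<^sub>m n"
    using det_non_zero_imp_unit[OF A, of "()"] by (auto simp: Units_def ring_mat_def)
  then have "A *\<^sub>v (B *\<^sub>v b) = b"
    using A b by (metis assoc_mult_mat_vec one_mult_mat_vec)
  with that B b show ?thesis by (meson mult_mat_vec_carrier)
qed

text \<open>The exact second-order Taylor expansion at \<open>v\<close>: gradient paired with
  \<open>h\<close>, plus half the Hessian form at \<open>h\<close>.\<close>

lemma stage_loss_add:
  assumes S: "S \<in> carrier_mat n n" "transpose_mat S = S"
    and H: "H \<in> carrier_mat n n" "transpose_mat H = H"
    and "a \<in> carrier_vec n" "b \<in> carrier_vec n" "v \<in> carrier_vec n" "h \<in> carrier_vec n"
  shows "stage_loss lam S H a b (v + h) = stage_loss lam S H a b v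
    + h \<bullet> (S *\<^sub>v (v - a)) + lam * (h \<bullet> (H *\<^sub>v (v - b)))
    + 1 / 2 * (h \<bullet> (S *\<^sub>v h) + lam * (h \<bullet> (H *\<^sub>v h)))"
proof -
  have "v + h - a = (v - a) + h" "v + h - b = (v - b) + h"
    and "v - a \<in> carrier_vec n" "v - b \<in> carrier_vec n"
    using assms by auto
  with S H \<open>h \<in> carrier_vec n\<close> show ?thesis
    unfolding stage_loss_def by (simp add: quadratic_form_add[of _ n] field_simps)
qed

text \<open>\<open>arg_min_on\<close> is a choice operator and has a value even where no minimiser
  exists; the first conjunct certifies that \<open>vhat\<close> is a genuine and unique
  minimiser.\<close>

theorem proposition1:
  fixes m G r :: nat
    and d :: "nat \<Rightarrow> nat"
    and lam :: real
    and S H :: "real mat"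
    and Hb :: "nat \<Rightarrow> real mat"
    and vstar vprev vhat :: "real vec"
    and q :: "nat \<Rightarrow> real vec"
    and \<rho> :: "nat \<Rightarrow> real"
  assumes "m \<ge> 1" and "G \<ge> 1"
    and "\<And>g. g < G \<Longrightarrow> d g \<ge> 1"
    and "(\<Sum>g<G. d g) = m"
    and "lam > 0"
    and "sym_psd m S"
    and "\<And>g. g < G \<Longrightarrow> sym_psd (d g) (Hb g)"
    and "H = diag_block_mat (map Hb [0..<G])"
    and "mat_kernel S \<inter> mat_kernel H = {0\<^sub>v m}"
    and "vstar \<in> carrier_vec m" and "vprev \<in> carrier_vec m"
    and "vhat = arg_min_on (stage_loss lam S H vstar vprev) (carrier_vec m)"
    and "r = vec_space.rank m H"
    and "\<And>k. k \<in> {1..r} \<Longrightarrow> gen_eigenpair_on_range S H (q k) (\<rho> k)"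
    and "\<And>i j. i \<in> {1..r} \<Longrightarrow> j \<in> {1..r} \<Longrightarrow>
           mat_inner H (q i) (q j) = (if i = j then 1 else 0)"
  shows "(\<exists>!v. is_arg_min (stage_loss lam S H vstar vprev) (\<lambda>v. v \<in> carrier_vec m) v)
    \<and> (\<forall>k\<in>{1..r}. mat_inner H vhat (q k)
          = \<rho> k / (\<rho> k + lam) * mat_inner H vstar (q k)
            + lam / (\<rho> k + lam) * mat_inner H vprev (q k))"
proof -
  let ?L = "stage_loss lam S H vstar vprev"
  note lam = \<open>lam > 0\<close> and S = \<open>sym_psd m S\<close> and a = \<open>vstar \<in> carrier_vec m\<close>
    and b = \<open>vprev \<in> carrier_vec m\<close>
  have dimHb: "dim_row (Hb g) = d g" if "g < G" for g
    using assms(7)[OF that] by (auto simp: sym_psd_def)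
  then have "map dim_row (map Hb [0..<G]) = map d [0..<G]"
    by auto
  then have "sum_list (map dim_row (map Hb [0..<G])) = m"
    using assms(4) by (simp add: interv_sum_list_conv_sum_set_nat atLeast0LessThan)
  moreover have "sym_psd (dim_row A) A" if "A \<in> set (map Hb [0..<G])" for A
    using that assms(7) dimHb by auto
  ultimately have H: "sym_psd m H"
    using sym_psd_diag_block_mat[of "map Hb [0..<G]"] assms(8) by simp
  have cS: "S \<in> carrier_mat m m" "transpose_mat S = S"
    and cH: "H \<in> carrier_mat m m" "transpose_mat H = H"
    using S H by (auto simp: sym_psd_def)
  have Sx: "0 \<le> x \<bullet> (S *\<^sub>v x)" and Hx: "0 \<le> x \<bullet> (H *\<^sub>v x)" if "x \<in> carrier_vec m" for x
    using that S H by (auto simp: sym_psd_def)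
  \<comment> \<open>If the sum of the two nonnegative terms were not positive, both would vanish,
    placing \<open>x\<close> in both kernels.\<close>
  have pd: "0 < x \<bullet> (S *\<^sub>v x) + lam * (x \<bullet> (H *\<^sub>v x))"
    if x: "x \<in> carrier_vec m" "x \<noteq> 0\<^sub>v m" for x
  proof (rule ccontr)
    assume "\<not> ?thesis"
    moreover have "0 \<le> lam * (x \<bullet> (H *\<^sub>v x))" using lam Hx x by simp
    ultimately have "x \<bullet> (S *\<^sub>v x) = 0" "lam * (x \<bullet> (H *\<^sub>v x)) = 0"
      using Sx[OF x(1)] by linarith+
    then have "S *\<^sub>v x = 0\<^sub>v m" "H *\<^sub>v x = 0\<^sub>v m"
      using sym_psd_quadratic_form_eq_0[OF S x(1)] sym_psd_quadratic_form_eq_0[OF H x(1)] lam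
      by simp_all
    then have "x \<in> mat_kernel S \<inter> mat_kernel H"
      using x cS cH by (auto simp: mat_kernel_def)
    with assms(9) x show False by simp
  qed
  let ?A = "S + lam \<cdot>\<^sub>m H"
  have cA: "?A \<in> carrier_mat m m" using cS cH by simp
  have "(lam \<cdot>\<^sub>m H) *\<^sub>v x = lam \<cdot>\<^sub>v (H *\<^sub>v x)" if "x \<in> carrier_vec m" for x
    using that cH by (intro eq_vecI) auto
  then have Ax: "?A *\<^sub>v x = S *\<^sub>v x + lam \<cdot>\<^sub>v (H *\<^sub>v x)" if "x \<in> carrier_vec m" for x
    using that cS cH by (simp add: add_mult_distrib_mat_vec[of _ m m])
  have xAx: "h \<bullet> (?A *\<^sub>v x) = h \<bullet> (S *\<^sub>v x) + lam * (h \<bullet> (H *\<^sub>v x))"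
    if "x \<in> carrier_vec m" "h \<in> carrier_vec m" for x h
    using that cS cH by (simp add: Ax scalar_prod_add_distrib[of _ m])
  have "x = 0\<^sub>v m" if "x \<in> carrier_vec m" "?A *\<^sub>v x = 0\<^sub>v m" for x
    using pd[of x] xAx[of x x] that by force
  then obtain v where v: "v \<in> carrier_vec m"
    and Av: "?A *\<^sub>v v = S *\<^sub>v vstar + lam \<cdot>\<^sub>v (H *\<^sub>v vprev)"
    using injective_mat_imp_surj[OF cA, of "S *\<^sub>v vstar + lam \<cdot>\<^sub>v (H *\<^sub>v vprev)"] cS cH a b
    by auto
  \<comment> \<open>The normal equation tested against an arbitrary \<open>h\<close>. It serves
    twice: with \<open>h = w - v\<close> for minimality, and with \<open>h = q k\<close> for the
    spectral identity.\<close>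
  have normal: "h \<bullet> (S *\<^sub>v v) + lam * (h \<bullet> (H *\<^sub>v v))
      = h \<bullet> (S *\<^sub>v vstar) + lam * (h \<bullet> (H *\<^sub>v vprev))"
    if h: "h \<in> carrier_vec m" for h
    using xAx[OF v h] h cS cH a b by (simp add: Av scalar_prod_add_distrib[of _ m])
  have less: "?L v < ?L w" if w: "w \<in> carrier_vec m" "w \<noteq> v" for w
  proof -
    define h where "h = w - v"
    have h: "h \<in> carrier_vec m" and wh: "w = v + h" using w v by (auto simp: h_def)
    then have "h \<noteq> 0\<^sub>v m" using w v by auto
    \<comment> \<open>The first-order terms cancel by \<open>normal\<close>, so the gap between the
      losses is half the positive definite form at \<open>h\<close>.\<close>
    from pd[OF h this] show ?thesis
      unfolding wh stage_loss_add[OF cS cH a b v h]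
      using normal[OF h] h v a b cS cH
      by (simp add: mult_minus_distrib_mat_vec scalar_prod_minus_distrib[of _ m] algebra_simps)
  qed
  have min: "is_arg_min ?L (\<lambda>v. v \<in> carrier_vec m) w \<longleftrightarrow> w = v" for w
    using less v by (auto simp: is_arg_min_def) (metis less_asym)
  \<comment> \<open>The choice behind \<open>arg_min_on\<close> is forced, since \<open>v\<close> is
    the only candidate.\<close>
  then have vhat: "vhat = v"
    using assms(12) by (simp add: arg_min_on_def arg_min_def)
  have "mat_inner H v (q k) = \<rho> k / (\<rho> k + lam) * mat_inner H vstar (q k)
            + lam / (\<rho> k + lam) * mat_inner H vprev (q k)" if k: "k \<in> {1..r}" for k
  proof -
    have q: "q k \<in> carrier_vec m" and Sq: "S *\<^sub>v q k = \<rho> k \<cdot>\<^sub>v (H *\<^sub>v q k)"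
      using assms(14)[OF k] cH by (auto simp: gen_eigenpair_on_range_def mat_range_def)
    have S_eq: "q k \<bullet> (S *\<^sub>v x) = \<rho> k * mat_inner H x (q k)" if x: "x \<in> carrier_vec m" for x
      using symmetric_scalar_prod[OF cS x q] Sq cH q x by (simp add: mat_inner_def)
    have H_eq: "q k \<bullet> (H *\<^sub>v x) = mat_inner H x (q k)" if x: "x \<in> carrier_vec m" for x
      using symmetric_scalar_prod[OF cH x q] by (simp add: mat_inner_def)
    \<comment> \<open>By the normalisation, \<open>\<rho> k\<close> is the value of the form of
      \<open>S\<close> at \<open>q k\<close>; hence the denominator \<open>\<rho> k + lam\<close> is
      positive.\<close>
    have "0 \<le> \<rho> k" using Sx[OF q] S_eq[OF q] assms(15)[OF k k] by simp
    with lam have "\<rho> k + lam \<noteq> 0" by simp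
    moreover have "(\<rho> k + lam) * mat_inner H v (q k)
        = \<rho> k * mat_inner H vstar (q k) + lam * mat_inner H vprev (q k)"
      using normal[OF q] S_eq H_eq v a b by (simp add: algebra_simps)
    ultimately show ?thesis by (simp add: eq_divide_eq mult.commute flip: add_divide_distrib)
  qed
  then show ?thesis unfolding min vhat by simp
qed

end
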